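(* Let $M=2$, and consider the scheduling problem (SP) of the context with $p_{max}<\alpha(\eta_1P_1+\eta_2P_2)$. Suppose that it has an optimal solution and that the power constraint is tight at the optimum. Then the optimal transmission probabilities can be expressed as $g^*_{i,1}=f^*_{i+1,1}=1$ for all $i\ge0$, and $$\begin{cases}g^*_{i,2}=f^*_{i+1,2}=0,& i<i_2^*-1,\\ \eta_2\left(\pi_i^*g^*_{i,2}+\xi\pi^*_{i+1}f^*_{i+1,2}\right)=\eta_2y^*_{i,2},& i=i_2^*-1,\\ g^*_{i,2}=f^*_{i+1,2}=1,& i\ge i_2^*,\end{cases}$$ where $\{\pi_i^*\}$ is the stationary queue-length distribution at the optimum, $\{y^*_{i,m}\}$ is an optimal solution of the linear program (LP) of the context with $\pi_i^*=\eta_1y^*_{i,1}+\eta_2y^*_{i,2}$, and the threshold $i_2^*$ is given by $$i_2^*=\begin{cases}\left\lfloor\log_{\frac{1-\eta_1}{\eta_1\xi}}\left(1-\frac1{\pi_0^*}\left(1-\frac{1-\eta_1}{\eta_1\xi}\right)\right)\right\rfloor,&\frac{1-\eta_1}{\eta_1\xi}\ne1,\\ \left\lfloor(\pi_0^* )^{-1}\right\rfloor,&\frac{1-\eta_1}{\eta_1\xi}=1.\end{cases}$$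
   Context: Data: $M=2$, $\mathcal M=\{1,2\}$; $\alpha\in(0,1)$; $\xi=\frac{1-\alpha}{\alpha}$; channel state probabilities $\eta_1,\eta_2>0$ with $\eta_1+\eta_2=1$; powers $0<P_1\le P_2$; buffer capacity $Q$, a positive integer or $\infty$; $\mathcal Q=\{0,1,\dots,Q\}$ (all nonnegative integers if $Q=\infty$); a maximum average power $p_{max}$. Scheduling model. Time is slotted. In each slot one packet arrives with probability $\alpha$ (none otherwise), and independently the channel is in state $m$ with probability $\eta_m$; arrivals and channel states are i.i.d. over slots. If the queue length at the end of the previous slot is $i$ and the channel state is $m$, the source transmits one packet (using power $P_m$) with probability $g_{i,m}$ if a packet arrives in the slot, and with probability $f_{i,m}$ if none arrives (for $i\ge1$; with $i=0$ and no arrival nothing is sent). The queue length is a birth–death Markov chain on $\mathcal Q$ with up-rates $\lambda_i=\alpha\sum_m\eta_m(1-g_{i,m})$ ($0\le i\le Q-1$) and down-rates $\mu_i=(1-\alpha)\sum_m\eta_mf_{i,m}$ ($1\le i\le Q$) and stationary distribution $\{\pi_i\}$. Problem (SP): minimize, over $g_{i,m},f_{i,m}\in[0,1]$, the average delay $\bar D=\frac1\alpha\sum_{i=0}^Qi\pi_i$ subject to $$\bar P=\sum_{m=1}^2\Big(\alpha\sum_{i=0}^Q\pi_i\eta_mg_{i,m}+(1-\alpha)\sum_{i=1}^Q\pi_i\eta_mf_{i,m}\Big)P_m\le p_{max}$$ (tight means equality), $\pi_i\lambda_i=\pi_{i+1}\mu_{i+1}$ for $0\le i<Q$, $\sum_{i=0}^Q\pi_i=1$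 ($\pi_i\ge0$), and the no-buffer-overflow assumption ($\pi_Q=0$ if $Q<\infty$). (LP), in variables $\{y_{i,m}\}_{i\in\mathcal Q,m\in\mathcal M}$: minimize $\bar D=\frac1\alpha\sum_{i=0}^{Q}\sum_{m=1}^{2}i\eta_my_{i,m}$ subject to $\alpha\sum_{i=0}^{Q}\sum_{m=1}^{2}\eta_mP_my_{i,m}\le p_{max}$; $\sum_{i=0}^{Q}\sum_{m=1}^{2}\eta_my_{i,m}=1$; $0\le y_{i,m}\le\sum_{n}\eta_ny_{i,n}+\xi\sum_{n}\eta_ny_{i+1,n}$ for all $i\in\mathcal Q,m\in\mathcal M$; and, if $Q<\infty$, $y_{Q,m}=0$ for all $m$. It arises from (SP) by setting $y_{i,m}=\pi_ig_{i,m}+\xi\pi_{i+1}f_{i+1,m}$. Conventions: $y_{i,m}=\pi_i=0$ for $i<0$ and $i>Q$; assertions about $g_{i,m}$ are for $0\le i\le Q$ and about $f_{i,m}$ for $1\le i\le Q$; assertions about indices outside these ranges are void. *)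

theory Defs
  imports "HOL-Analysis.Analysis"
begin

definition states :: "enat \<Rightarrow> nat set" where
  "states Q = {i. enat i \<le> Q}"

definition xi :: "real \<Rightarrow> real" where
  "xi \<alpha> = (1 - \<alpha>) / \<alpha>"

definition up_rate :: "real \<Rightarrow> (nat \<Rightarrow> real) \<Rightarrow> (nat \<Rightarrow> nat \<Rightarrow> real) \<Rightarrow> nat \<Rightarrow> real" where
  "up_rate \<alpha> \<eta> g i = \<alpha> * (\<Sum>m\<in>{1,2}. \<eta> m * (1 - g i m))"

definition down_rate :: "real \<Rightarrow> (nat \<Rightarrow> real) \<Rightarrow> (nat \<Rightarrow> nat \<Rightarrow> real) \<Rightarrow> nat \<Rightarrow> real" where
  "down_rate \<alpha> \<eta> f i = (1 - \<alpha>) * (\<Sum>m\<in>{1,2}. \<eta> m * f i m)"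

text \<open>The delays take values in \<^typ>\<open>ennreal\<close>: for an infinite buffer the mean queue length of a
  feasible point may be infinite. The power series below, in contrast, converge at every feasible
  point, by comparison with the normalisation constraint.\<close>

definition sp_delay :: "real \<Rightarrow> enat \<Rightarrow> (nat \<Rightarrow> real) \<Rightarrow> ennreal" where
  "sp_delay \<alpha> Q \<pi> = ennreal (1 / \<alpha>) * (\<Sum>\<^sub>\<infinity>i\<in>states Q. ennreal (real i * \<pi> i))"

definition sp_power ::
  "real \<Rightarrow> (nat \<Rightarrow> real) \<Rightarrow> (nat \<Rightarrow> real) \<Rightarrow> enat \<Rightarrow>
    (nat \<Rightarrow> nat \<Rightarrow> real) \<Rightarrow> (nat \<Rightarrow> nat \<Rightarrow> real) \<Rightarrow> (nat \<Rightarrow> real) \<Rightarrow> real" where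
  "sp_power \<alpha> \<eta> P Q g f \<pi> =
    (\<Sum>m\<in>{1,2}. (\<alpha> * (\<Sum>\<^sub>\<infinity>i\<in>states Q. \<pi> i * \<eta> m * g i m)
                 + (1 - \<alpha>) * (\<Sum>\<^sub>\<infinity>i\<in>states Q - {0}. \<pi> i * \<eta> m * f i m)) * P m)"

text \<open>The transmission probabilities may make the birth-death chain reducible, so that they do not
  determine the stationary distribution; it is therefore a variable of the problem, tied to them by
  the balance equations. Values at indices above \<open>Q\<close> are zero by convention.\<close>

definition sp_feasible ::
  "real \<Rightarrow> (nat \<Rightarrow> real) \<Rightarrow> (nat \<Rightarrow> real) \<Rightarrow> enat \<Rightarrow> real \<Rightarrow>
    (nat \<Rightarrow> nat \<Rightarrow> real) \<Rightarrow> (nat \<Rightarrow> nat \<Rightarrow> real) \<Rightarrow> (nat \<Rightarrow> real) \<Rightarrow> bool" where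
  "sp_feasible \<alpha> \<eta> P Q pmax g f \<pi> \<longleftrightarrow>
    (\<forall>i\<in>states Q. \<forall>m\<in>{1,2}. 0 \<le> g i m \<and> g i m \<le> 1) \<and>
    (\<forall>i\<in>states Q - {0}. \<forall>m\<in>{1,2}. 0 \<le> f i m \<and> f i m \<le> 1) \<and>
    (\<forall>i\<in>states Q. 0 \<le> \<pi> i) \<and>
    (\<forall>i. i \<notin> states Q \<longrightarrow> \<pi> i = 0) \<and>
    (\<pi> has_sum 1) (states Q) \<and>
    (\<forall>i. enat i < Q \<longrightarrow> \<pi> i * up_rate \<alpha> \<eta> g i = \<pi> (Suc i) * down_rate \<alpha> \<eta> f (Suc i)) \<and>
    (\<forall>i. enat i = Q \<longrightarrow> \<pi> i = 0) \<and>
    sp_power \<alpha> \<eta> P Q g f \<pi> \<le> pmax"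

definition sp_optimal ::
  "real \<Rightarrow> (nat \<Rightarrow> real) \<Rightarrow> (nat \<Rightarrow> real) \<Rightarrow> enat \<Rightarrow> real \<Rightarrow>
    (nat \<Rightarrow> nat \<Rightarrow> real) \<Rightarrow> (nat \<Rightarrow> nat \<Rightarrow> real) \<Rightarrow> (nat \<Rightarrow> real) \<Rightarrow> bool" where
  "sp_optimal \<alpha> \<eta> P Q pmax g f \<pi> \<longleftrightarrow>
    is_arg_min (\<lambda>(g, f, \<pi>). sp_delay \<alpha> Q \<pi>)
      (\<lambda>(g, f, \<pi>). sp_feasible \<alpha> \<eta> P Q pmax g f \<pi>) (g, f, \<pi>)"

definition lp_delay :: "real \<Rightarrow> (nat \<Rightarrow> real) \<Rightarrow> enat \<Rightarrow> (nat \<Rightarrow> nat \<Rightarrow> real) \<Rightarrow> ennreal" where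
  "lp_delay \<alpha> \<eta> Q y =
    ennreal (1 / \<alpha>) * (\<Sum>\<^sub>\<infinity>i\<in>states Q. \<Sum>m\<in>{1,2}. ennreal (real i * \<eta> m * y i m))"

definition lp_feasible ::
  "real \<Rightarrow> (nat \<Rightarrow> real) \<Rightarrow> (nat \<Rightarrow> real) \<Rightarrow> enat \<Rightarrow> real \<Rightarrow> (nat \<Rightarrow> nat \<Rightarrow> real) \<Rightarrow> bool" where
  "lp_feasible \<alpha> \<eta> P Q pmax y \<longleftrightarrow>
    \<alpha> * (\<Sum>\<^sub>\<infinity>i\<in>states Q. \<Sum>m\<in>{1,2}. \<eta> m * P m * y i m) \<le> pmax \<and>
    ((\<lambda>i. \<Sum>m\<in>{1,2}. \<eta> m * y i m) has_sum 1) (states Q) \<and>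
    (\<forall>i\<in>states Q. \<forall>m\<in>{1,2}. 0 \<le> y i m \<and>
      y i m \<le> (\<Sum>n\<in>{1,2}. \<eta> n * y i n) + xi \<alpha> * (\<Sum>n\<in>{1,2}. \<eta> n * y (Suc i) n)) \<and>
    (\<forall>i. i \<notin> states Q \<longrightarrow> (\<forall>m\<in>{1,2}. y i m = 0)) \<and>
    (\<forall>i. enat i = Q \<longrightarrow> (\<forall>m\<in>{1,2}. y i m = 0))"

definition lp_optimal ::
  "real \<Rightarrow> (nat \<Rightarrow> real) \<Rightarrow> (nat \<Rightarrow> real) \<Rightarrow> enat \<Rightarrow> real \<Rightarrow> (nat \<Rightarrow> nat \<Rightarrow> real) \<Rightarrow> bool" where
  "lp_optimal \<alpha> \<eta> P Q pmax y \<longleftrightarrow> is_arg_min (lp_delay \<alpha> \<eta> Q) (lp_feasible \<alpha> \<eta> P Q pmax) y"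

text \<open>\<open>r\<close> stands for \<open>(1 - \<eta>\<^sub>1) / (\<eta>\<^sub>1 \<xi>)\<close> and \<open>p0\<close> for the probability of an empty queue. The argument of
  the logarithm vanishes only if \<open>p0 = 1 - r\<close>, hence \<open>r < 1\<close> (the geometric distribution on an
  infinite buffer, where the second channel state is never used); the logarithm to base \<open>r\<close> of
  zero is then \<open>\<infinity>\<close>, whereas the library function \<^const>\<open>log\<close> returns zero.\<close>

definition threshold :: "real \<Rightarrow> real \<Rightarrow> ereal" where
  "threshold r p0 =
    (if r \<noteq> 1 then
       (let x = 1 - 1 / p0 * (1 - r)
        in if x = 0 then \<infinity> else ereal (of_int \<lfloor>log r x\<rfloor>))
     else ereal (of_int \<lfloor>inverse p0\<rfloor>))"

end

theory Submission
  imports Defs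
begin

text \<open>Put \<open>y\<^sub>i\<^sub>,\<^sub>m = \<pi>\<^sub>i g\<^sub>i\<^sub>,\<^sub>m + \<xi> \<pi>\<^sub>i\<^sub>+\<^sub>1 f\<^sub>i\<^sub>+\<^sub>1\<^sub>,\<^sub>m\<close> and let \<open>T\<^sub>k = \<pi>\<^sub>k + \<pi>\<^sub>k\<^sub>+\<^sub>1 + \<dots>\<close>, so that the mean queue
  length is \<open>T\<^sub>1 + T\<^sub>2 + \<dots>\<close>. The bound on \<open>y\<^sub>i\<^sub>,\<^sub>1\<close> gives \<open>r \<pi>\<^sub>i - \<pi>\<^sub>i\<^sub>+\<^sub>1 \<le> r y\<^sub>i\<^sub>,\<^sub>2\<close> with
  \<open>r = \<eta>\<^sub>2 / (\<eta>\<^sub>1 \<xi>)\<close>, and the power constraint is \<open>r \<Sum>\<^sub>i y\<^sub>i\<^sub>,\<^sub>2 \<le> \<sigma>\<close> for a constant \<open>\<sigma>\<close>. Summing over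
  \<open>i \<ge> k\<close> yields \<open>T\<^sub>k\<^sub>+\<^sub>1 \<ge> max 0 (r T\<^sub>k - \<sigma>)\<close>, so every feasible tail sequence dominates pointwise the
  one where equality holds throughout. The latter is feasible and has finite delay, hence it is the
  tail sequence of every optimal point: a truncated geometric distribution, attained by always
  using the first channel state fully.\<close>

section \<open>Truncated geometric tails and the closed formula of the threshold\<close>

definition geo_sum :: "real \<Rightarrow> nat \<Rightarrow> real" where
  "geo_sum r k = (\<Sum>i<k. r ^ i)"

text \<open>Masses \<open>p * r ^ i\<close> have tails \<open>1 - p * geo_sum r k\<close>; the
  maximum with 0 stops them once the total mass 1 is used up. Keeping \<open>geo_sum\<close> as a
  sum treats \<open>r = 1\<close> uniformly.\<close>

definition geo_tail :: "real \<Rightarrow> real \<Rightarrow> nat \<Rightarrow> real" where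
  "geo_tail r p k = max 0 (1 - p * geo_sum r k)"

lemma geo_sum_0 [simp]: "geo_sum r 0 = 0"
  by (simp add: geo_sum_def)

lemma geo_sum_Suc: "geo_sum r (Suc k) = 1 + r * geo_sum r k"
  by (simp add: geo_sum_def sum.lessThan_Suc_shift sum_distrib_left del: sum.lessThan_Suc)

lemma geo_sum_Suc': "geo_sum r (Suc k) = geo_sum r k + r ^ k"
  by (simp add: geo_sum_def)

lemma geo_sum_mono: "geo_sum r j \<le> geo_sum r k" if "j \<le> k" "0 \<le> r"
  unfolding geo_sum_def using that by (intro sum_mono2) auto

lemma geo_sum_eq: "geo_sum r k = (1 - r ^ k) / (1 - r)" if "r \<noteq> 1"
  using that by (simp add: geo_sum_def sum_gp_strict)

lemma geo_sum_ge: "real k \<le> geo_sum r k" if "1 \<le> r"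
proof -
  have "(\<Sum>i<k. 1) \<le> (\<Sum>i<k. r ^ i)"
    using that by (intro sum_mono one_le_power)
  then show ?thesis by (simp add: geo_sum_def)
qed

lemma geo_tail_0 [simp]: "geo_tail r p 0 = 1"
  by (simp add: geo_tail_def)

lemma geo_tail_nonneg [simp]: "0 \<le> geo_tail r p k"
  by (simp add: geo_tail_def)

lemma geo_tail_antimono: "geo_tail r p k \<le> geo_tail r p j"
  if "j \<le> k" "0 \<le> r" "0 \<le> p"
  using mult_left_mono[OF geo_sum_mono[OF that(1,2)] that(3)] by (simp add: geo_tail_def)

text \<open>The affine map with slope \<open>r\<close> and offset \<open>p - 1 + r\<close> produces
  the untruncated sequence. As the offset is nonnegative, a value at or below 0 stays there, so
  truncation commutes with the map.\<close>

lemma geo_tail_Suc: "geo_tail r p (Suc k) = max 0 (r * geo_tail r p k - (p - 1 + r))"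
  if "0 \<le> r" "0 \<le> p - 1 + r"
proof (cases "1 - p * geo_sum r k \<ge> 0")
  case True
  then show ?thesis by (simp add: geo_tail_def geo_sum_Suc algebra_simps)
next
  case False
  then have "r * (1 - p * geo_sum r k) \<le> 0"
    using that by (simp add: mult_nonneg_nonpos)
  with False that show ?thesis by (simp add: geo_tail_def geo_sum_Suc algebra_simps)
qed

lemma geo_tail_lower_bound:
  fixes \<pi> u :: "nat \<Rightarrow> real"
  assumes "\<pi> sums 1" "\<And>i. 0 \<le> u i" "u sums U" "U \<le> \<sigma>" "0 \<le> r"
    and d: "\<And>i. r * \<pi> i - \<pi> (Suc i) \<le> u i"
    and nn: "\<And>i. 0 \<le> \<pi> i"
  shows "geo_tail r (1 - r + \<sigma>) k \<le> 1 - (\<Sum>j<k. \<pi> j)"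
proof -
  define T where "T k = 1 - (\<Sum>j<k. \<pi> j)" for k
  have sT: "(\<lambda>j. \<pi> (j + k)) sums T k" for k
    unfolding T_def using sums_split_initial_segment[OF assms(1)] by simp
  have su: "(\<lambda>j. u (j + k)) sums (U - (\<Sum>j<k. u j))" for k
    using sums_split_initial_segment[OF assms(3)] by simp
  have step: "r * T k - \<sigma> \<le> T (Suc k)" for k
  proof -
    have "(\<lambda>j. r * \<pi> (j + k) - \<pi> (j + Suc k)) sums (r * T k - T (Suc k))"
      by (intro sums_diff sums_mult sT)
    then have "r * T k - T (Suc k) \<le> U - (\<Sum>j<k. u j)"
      using d by (intro sums_le[OF _ _ su]) auto
    \<comment> \<open>What the first \<open>k\<close> terms spend is nonnegative, so the rest of the
      budget is still at most \<open>\<sigma>\<close>.\<close>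
    moreover have "0 \<le> (\<Sum>j<k. u j)" using assms(2) by (simp add: sum_nonneg)
    ultimately show ?thesis using assms(4) by linarith
  qed
  have "0 \<le> T k" using sums_le[OF _ sums_zero sT[of k]] nn by simp
  \<comment> \<open>The induction runs on the untruncated affine recursion;
    \<open>0 \<le> T k\<close> then supplies the maximum with 0.\<close>
  moreover have "1 - (1 - r + \<sigma>) * geo_sum r k \<le> T k"
  proof (induction k)
    case (Suc k)
    have "1 - (1 - r + \<sigma>) * geo_sum r (Suc k) = r * (1 - (1 - r + \<sigma>) * geo_sum r k) - \<sigma>"
      by (simp add: geo_sum_Suc algebra_simps)
    also have "\<dots> \<le> r * T k - \<sigma>" using mult_left_mono[OF Suc assms(5)] by simp
    finally show ?case using step[of k] by linarith
  qed (simp add: T_def)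
  ultimately show ?thesis by (simp add: geo_tail_def T_def)
qed

text \<open>If truncation never acts, \<open>r \<ge> 1\<close> is impossible because the sums would
  grow at least linearly; for \<open>r < 1\<close> the limit \<open>1 - p / (1 - r)\<close> of the
  tails must be 0.\<close>

lemma geo_sum_bounded:
  assumes "0 < r" "0 < p" "geo_tail r p \<longlonglongrightarrow> 0" "\<And>k. p * geo_sum r k \<le> 1"
  shows "r < 1 \<and> p = 1 - r"
proof -
  have "r < 1"
  proof (rule ccontr)
    assume "\<not> r < 1"
    obtain k :: nat where "1 / p < k" using reals_Archimedean2 by blast
    then have "1 < p * k" using assms(2) by (simp add: field_simps)
    also have "\<dots> \<le> p * geo_sum r k"
      using \<open>\<not> r < 1\<close> assms(2) by (intro mult_left_mono geo_sum_ge) auto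
    finally show False using assms(4)[of k] by simp
  qed
  have "(\<lambda>k. 1 - p * ((1 - r ^ k) / (1 - r))) \<longlonglongrightarrow> 1 - p * ((1 - 0) / (1 - r))"
    using assms(1) \<open>r < 1\<close> by (intro tendsto_intros LIMSEQ_realpow_zero) auto
  moreover have "geo_tail r p = (\<lambda>k. 1 - p * ((1 - r ^ k) / (1 - r)))"
    using assms(4) \<open>r < 1\<close> by (auto simp: geo_tail_def geo_sum_eq fun_eq_iff)
  ultimately have "1 - p * ((1 - 0) / (1 - r)) = 0"
    using assms(3) LIMSEQ_unique by metis
  then show ?thesis using \<open>r < 1\<close> by (simp add: field_simps)
qed

text \<open>Either the tails are the powers of some \<open>r < 1\<close>, or they vanish from some
  index on. This is the finite delay of the extremal point.\<close>

lemma summable_geo_tail: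
  assumes "0 < r" "0 < p" "geo_tail r p \<longlonglongrightarrow> 0"
  shows "summable (geo_tail r p)"
proof (cases "\<forall>k. p * geo_sum r k \<le> 1")
  case True
  with geo_sum_bounded[OF assms] have "r < 1" "p = 1 - r" by auto
  then have "geo_tail r p = (\<lambda>k. r ^ k)"
    using assms(1) by (auto simp: geo_tail_def geo_sum_eq fun_eq_iff)
  with \<open>r < 1\<close> assms(1) show ?thesis by (simp add: summable_geometric)
next
  case False
  then obtain n where n: "1 < p * geo_sum r n" by (auto simp: not_le)
  have "geo_tail r p k = 0" if "n \<le> k" for k
    using geo_tail_antimono[OF that, of r p] assms n geo_tail_nonneg[of r p k]
    by (simp add: geo_tail_def)
  then show ?thesis by (intro summable_finite[of "{..<n}"]) auto
qed

text \<open>The logarithm in \<open>threshold\<close> solves \<open>p * geo_sum r n \<le> 1\<close>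
  for the largest \<open>n\<close>; the infinite value is the case in which every \<open>n\<close>
  qualifies.\<close>

lemma threshold_cases:
  assumes "0 < r" "0 < p" "p \<le> 1" "geo_tail r p \<longlonglongrightarrow> 0"
  obtains "threshold r p = \<infinity>" "\<And>k. p * geo_sum r k \<le> 1"
  | n where "threshold r p = ereal (real n)" "p * geo_sum r n \<le> 1" "1 < p * geo_sum r (Suc n)"
proof (cases "\<forall>k. p * geo_sum r k \<le> 1")
  case True
  with geo_sum_bounded[OF assms(1,2,4)] have "r < 1" "p = 1 - r" by auto
  then have "threshold r p = \<infinity>" by (simp add: threshold_def Let_def)
  with True show thesis using that(1) by blast
next
  case False
  then obtain m where "1 < p * geo_sum r m" by (auto simp: not_le)
  \<comment> \<open>The first index that violates the bound is not 0, since
    \<open>geo_sum r 0 = 0\<close>; \<open>n\<close> is its predecessor.\<close>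
  from ex_least_nat_less[where P = "\<lambda>k. 1 < p * geo_sum r k", OF this] obtain n
    where n: "p * geo_sum r n \<le> 1" "1 < p * geo_sum r (Suc n)"
    by (auto simp: not_less)
  have thr: "threshold r p = ereal (real n)"
  proof (cases "r = 1")
    case True
    then have "\<lfloor>inverse p\<rfloor> = int n" using n assms(2)
      by (intro floor_unique) (auto simp: geo_sum_def field_simps)
    with True show ?thesis by (simp add: threshold_def)
  next
    case r1: False
    define x where "x = 1 - 1 / p * (1 - r)"
    have thr: "threshold r p = ereal (of_int \<lfloor>log r x\<rfloor>)" if "0 < x"
      using that r1 unfolding threshold_def Let_def x_def[symmetric] by simp
    show ?thesis
    proof (cases "r > 1")
      case True
      then have x: "r ^ n \<le> x" "x < r ^ Suc n"
        using n assms(2) by (auto simp: x_def geo_sum_eq field_simps)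
      then have "x > 0" using assms(1) by (smt (verit) zero_less_power)
      moreover have "\<lfloor>log r x\<rfloor> = int n"
        using x True \<open>x > 0\<close>
        by (intro floor_unique)
           (auto simp: le_log_iff log_less_iff powr_realpow powr_add mult_ac simp flip: of_nat_Suc)
      ultimately show ?thesis using thr \<open>x > 0\<close> by simp
    next
      case False
      with r1 have "r < 1" by simp
      then have x: "x \<le> r ^ n" "r ^ Suc n < x"
        using n assms(2) by (auto simp: x_def geo_sum_eq field_simps)
      then have "x > 0" using assms(1) by (smt (verit) zero_less_power)
      \<comment> \<open>Dividing by the negative \<open>ln r\<close> reverses both inequalities, so
        the logarithm again lies in \<open>[n, n + 1)\<close>.\<close>
      have ln: "ln r < 0" using \<open>r < 1\<close> assms(1) by simp
      have "ln x \<le> real n * ln r"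
        using x \<open>x > 0\<close> assms(1) by (metis ln_le_cancel_iff ln_realpow zero_less_power)
      moreover have "real (Suc n) * ln r < ln x"
        using x \<open>x > 0\<close> assms(1) by (metis ln_less_cancel_iff ln_realpow zero_less_power)
      ultimately have "\<lfloor>log r x\<rfloor> = int n"
        using ln by (intro floor_unique) (auto simp: log_def field_simps)
      then show ?thesis using thr \<open>x > 0\<close> by simp
    qed
  qed
  show thesis by (rule that(2)[OF thr n])
qed

section \<open>The mean queue length as a sum of tails\<close>

lemma delay_eq_tail_sum:
  fixes \<pi> :: "nat \<Rightarrow> real"
  assumes "\<pi> sums 1" and nn: "\<And>i. 0 \<le> \<pi> i"
  shows "(\<Sum>i. ennreal (real i * \<pi> i)) = (\<Sum>k. ennreal (1 - (\<Sum>j<Suc k. \<pi> j)))"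
proof -
  have "(\<Sum>i. ennreal (real i * \<pi> i)) = (\<Sum>i. \<Sum>k. if k < i then ennreal (\<pi> i) else 0)"
  proof (intro suminf_cong)
    fix i
    have "(\<Sum>k. if k < i then ennreal (\<pi> i) else 0) = (\<Sum>k<i. ennreal (\<pi> i))"
      by (subst suminf_finite[of "{..<i}"]) auto
    then show "ennreal (real i * \<pi> i) = (\<Sum>k. if k < i then ennreal (\<pi> i) else 0)"
      using nn by (simp add: ennreal_mult flip: ennreal_of_nat_eq_real_of_nat)
  qed
  \<comment> \<open>With \<open>i\<close> written as the number of \<open>k < i\<close>, the order
    of summation is exchanged by viewing the outer series as an integral over the counting measure;
    the mean may be infinite.\<close>
  also have "\<dots> = (\<integral>\<^sup>+i. (\<Sum>k. if k < i then ennreal (\<pi> i) else 0) \<partial>count_space UNIV)"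
    by (simp add: nn_integral_count_space_nat)
  also have "\<dots> = (\<Sum>k. \<integral>\<^sup>+i. (if k < i then ennreal (\<pi> i) else 0) \<partial>count_space UNIV)"
    by (rule nn_integral_suminf) simp
  also have "\<dots> = (\<Sum>k. \<Sum>i. if k < i then ennreal (\<pi> i) else 0)"
    by (simp add: nn_integral_count_space_nat)
  also have "\<dots> = (\<Sum>k. ennreal (1 - (\<Sum>j<Suc k. \<pi> j)))"
  proof (intro suminf_cong)
    fix k
    have "(\<lambda>i. \<pi> (i + Suc k)) sums (1 - (\<Sum>j<Suc k. \<pi> j))"
      using sums_split_initial_segment[OF assms(1), of "Suc k"] by simp
    then have "(\<Sum>i. ennreal (\<pi> (i + Suc k))) = ennreal (1 - (\<Sum>j<Suc k. \<pi> j))"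
      using nn by (intro suminf_ennreal_eq) auto
    moreover have "(\<Sum>i. if k < i then ennreal (\<pi> i) else 0) = (\<Sum>i. ennreal (\<pi> (i + Suc k)))"
      by (subst suminf_offset[of _ "Suc k"]) auto
    ultimately show "(\<Sum>i. if k < i then ennreal (\<pi> i) else 0) = ennreal (1 - (\<Sum>j<Suc k. \<pi> j))"
      by simp
  qed
  finally show ?thesis .
qed

text \<open>Summability of \<open>S\<close> makes both sums finite, so the nonnegative differences
  \<open>T k - S k\<close> have a sum that is at most 0.\<close>

lemma eq_if_suminf_ennreal_le:
  fixes S T :: "nat \<Rightarrow> real"
  assumes "summable S" "\<And>k. 0 \<le> S k" "\<And>k. S k \<le> T k"
    and le: "(\<Sum>k. ennreal (T k)) \<le> (\<Sum>k. ennreal (S k))"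
  shows "T = S"
proof -
  have nn: "0 \<le> T k" for k using assms(2,3) order_trans by blast
  have "(\<Sum>k. ennreal (S k)) \<noteq> top"
    using assms(1,2) by (simp add: suminf_ennreal_eq[OF _ summable_sums])
  with le have "(\<Sum>k. ennreal (T k)) \<noteq> top" by (auto simp: top_unique)
  then have sT: "summable T" using nn summable_suminf_not_top by blast
  have "ennreal (suminf T) \<le> ennreal (suminf S)"
    using le nn assms(1,2) sT by (simp add: suminf_ennreal_eq[OF _ summable_sums])
  then have "suminf T \<le> suminf S" using suminf_nonneg[OF assms(1,2)] by (simp add: ennreal_le_iff)
  then have "(\<Sum>k. T k - S k) \<le> 0" by (simp add: suminf_diff[OF sT assms(1), symmetric])
  then have "\<forall>k. T k - S k = 0"
    using suminf_eq_zero_iff[OF summable_diff[OF sT assms(1)]]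
      suminf_nonneg[OF summable_diff[OF sT assms(1)]] assms(3) by (metis antisym diff_ge_0_iff_ge)
  then show ?thesis by auto
qed

section \<open>The substitution from (SP) to (LP), and sums over the state space\<close>

definition flow :: "real \<Rightarrow> (nat \<Rightarrow> nat \<Rightarrow> real) \<Rightarrow> (nat \<Rightarrow> nat \<Rightarrow> real) \<Rightarrow> (nat \<Rightarrow> real) \<Rightarrow>
    nat \<Rightarrow> nat \<Rightarrow> real" where
  "flow \<alpha> g f \<pi> i m = \<pi> i * g i m + xi \<alpha> * \<pi> (Suc i) * f (Suc i) m"

lemma states_SucD: "Suc i \<in> states Q \<Longrightarrow> i \<in> states Q"
  unfolding states_def using order_trans[of "enat i" "enat (Suc i)"] by simp

text \<open>Extension by zero lets finite and infinite buffers be treated alike, as series over all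
  natural numbers.\<close>

lemma has_sum_states_iff:
  fixes h :: "nat \<Rightarrow> 'a::{comm_monoid_add, topological_space}"
  assumes "\<And>i. i \<notin> states Q \<Longrightarrow> h i = 0"
  shows "(h has_sum s) (states Q) \<longleftrightarrow> (h has_sum s) UNIV"
  using assms by (intro has_sum_cong_neutral) auto

lemma has_sum_states_iff_sums:
  fixes h :: "nat \<Rightarrow> real"
  assumes "\<And>i. i \<notin> states Q \<Longrightarrow> h i = 0" "\<And>i. 0 \<le> h i"
  shows "(h has_sum s) (states Q) \<longleftrightarrow> h sums s"
  using assms has_sum_states_iff[of Q h s] has_sum_imp_sums sums_nonneg_imp_has_sum by blast

lemma infsum_states_ennreal:
  fixes h :: "nat \<Rightarrow> ennreal"
  assumes "\<And>i. i \<notin> states Q \<Longrightarrow> h i = 0"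
  shows "(\<Sum>\<^sub>\<infinity>i\<in>states Q. h i) = (\<Sum>i. h i)"
proof -
  have "(h has_sum (\<Sum>\<^sub>\<infinity>i\<in>states Q. h i)) (states Q)"
    by (intro has_sum_infsum nonneg_summable_on_complete) simp
  with assms show ?thesis
    by (metis has_sum_states_iff has_sum_imp_sums sums_unique)
qed

lemma has_sum_flow:
  assumes "0 < \<alpha>" "\<alpha> < 1"
    and g: "\<And>i. i \<in> states Q \<Longrightarrow> 0 \<le> g i m \<and> g i m \<le> 1"
    and f: "\<And>i. i \<in> states Q - {0} \<Longrightarrow> 0 \<le> f i m \<and> f i m \<le> 1"
    and \<pi>: "\<And>i. i \<in> states Q \<Longrightarrow> 0 \<le> \<pi> i" "\<And>i. i \<notin> states Q \<Longrightarrow> \<pi> i = 0"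
      "\<pi> summable_on states Q"
  shows "((\<lambda>i. flow \<alpha> g f \<pi> i m) has_sum
      ((\<Sum>\<^sub>\<infinity>i\<in>states Q. \<pi> i * g i m) + xi \<alpha> * (\<Sum>\<^sub>\<infinity>i\<in>states Q - {0}. \<pi> i * f i m))) (states Q)"
proof -
  have "(\<lambda>i. \<pi> i * g i m) summable_on states Q"
    by (rule summable_on_comparison_test[OF \<pi>(3)]) (use g \<pi>(1) in \<open>auto intro: mult_left_le\<close>)
  moreover have "(\<lambda>i. \<pi> i * f i m) summable_on states Q - {0}"
    by (rule summable_on_comparison_test[OF summable_on_subset_banach[OF \<pi>(3)]])
       (use f \<pi>(1) in \<open>auto intro: mult_left_le\<close>)
  then have "((\<lambda>i. \<pi> i * f i m) has_sum (\<Sum>\<^sub>\<infinity>i\<in>states Q - {0}. \<pi> i * f i m)) (states Q - {0})"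
    by (rule has_sum_infsum)
  \<comment> \<open>The two index sets differ at most in \<open>Q + 1\<close>, where \<pi> is 0 by
    convention.\<close>
  then have "((\<lambda>i. \<pi> i * f i m) has_sum (\<Sum>\<^sub>\<infinity>i\<in>states Q - {0}. \<pi> i * f i m)) (Suc ` states Q)"
  proof (rule iffD1[OF has_sum_cong_neutral, rotated -1])
    fix i assume "i \<in> states Q - {0} - Suc ` states Q"
    then show "\<pi> i * f i m = 0" by (cases i) (auto dest: states_SucD)
  next
    fix i assume "i \<in> Suc ` states Q - (states Q - {0})"
    then show "\<pi> i * f i m = 0" using \<pi>(2)[of i] by auto
  qed simp
  then have "((\<lambda>i. xi \<alpha> * (\<pi> (Suc i) * f (Suc i) m)) has_sum
      (xi \<alpha> * (\<Sum>\<^sub>\<infinity>i\<in>states Q - {0}. \<pi> i * f i m))) (states Q)"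
    by (intro has_sum_cmult_right) (simp add: has_sum_reindex o_def)
  ultimately show ?thesis
    unfolding flow_def mult.assoc by (intro has_sum_add has_sum_infsum)
qed

section \<open>Correspondence between feasible points of (SP) and (LP)\<close>

locale two_state_channel =
  fixes \<alpha> pmax :: real and \<eta> P :: "nat \<Rightarrow> real" and Q :: enat
  assumes \<alpha>: "0 < \<alpha>" "\<alpha> < 1"
    and \<eta>: "0 < \<eta> 1" "0 < \<eta> 2" "\<eta> 1 + \<eta> 2 = 1"
    and P: "0 < P 1" "P 1 \<le> P 2"
    and pmax: "pmax < \<alpha> * (\<eta> 1 * P 1 + \<eta> 2 * P 2)"
begin

abbreviation \<xi> :: real where "\<xi> \<equiv> xi \<alpha>"

text \<open>The queue-length distribution recovered from a point of (LP).\<close>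

definition mass :: "(nat \<Rightarrow> nat \<Rightarrow> real) \<Rightarrow> nat \<Rightarrow> real" where
  "mass y i = \<eta> 1 * y i 1 + \<eta> 2 * y i 2"

definition r :: real where "r = (1 - \<eta> 1) / (\<eta> 1 * \<xi>)"

text \<open>The power left after charging every packet at \<open>P 1\<close>, rescaled so that the
  constraint bounds \<open>r\<close> times the sum of all \<open>y i 2\<close>. For
  \<open>P 1 = P 2\<close> the quotient is the default 0, but then no feasible point exists.\<close>

definition \<sigma> :: real where "\<sigma> = (pmax - \<alpha> * P 1) / (\<alpha> * (P 2 - P 1) * (\<eta> 1 * \<xi>))"

text \<open>This turns out to be the probability of an empty queue at the optimum.\<close>

definition p :: real where "p = 1 - r + \<sigma>"

lemma xi_pos: "0 < \<xi>"
  using \<alpha> by (simp add: xi_def)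

lemma r_pos: "0 < r"
  using \<eta> xi_pos by (simp add: r_def)

lemma \<eta>2_eq: "\<eta> 2 = r * (\<eta> 1 * \<xi>)"
  using \<eta> xi_pos by (simp add: r_def)

lemma sum_channel: "(\<Sum>m\<in>{1,2}. h m) = h 1 + h (2::nat)" for h :: "nat \<Rightarrow> 'a::comm_monoid_add"
  by simp

lemma lp_power_eq:
  assumes "((\<lambda>i. y i 1) has_sum a) A" "((\<lambda>i. y i 2) has_sum b) A"
  shows "\<alpha> * (\<Sum>\<^sub>\<infinity>i\<in>A. \<Sum>m\<in>{1,2}. \<eta> m * P m * y i m) = \<alpha> * (\<eta> 1 * P 1 * a + \<eta> 2 * P 2 * b)"
  unfolding sum_channel
  by (intro arg_cong[where f = "\<lambda>x. \<alpha> * x"] infsumI has_sum_add has_sum_cmult_right assms)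

text \<open>As \<open>1 - \<alpha> = \<alpha> * \<xi>\<close>, the slots with and without arrival
  combine into one sum over the flow.\<close>

lemma sp_power_eq:
  assumes g: "\<forall>i\<in>states Q. \<forall>m\<in>{1,2}. 0 \<le> g i m \<and> g i m \<le> 1"
    and f: "\<forall>i\<in>states Q - {0}. \<forall>m\<in>{1,2}. 0 \<le> f i m \<and> f i m \<le> 1"
    and \<pi>: "\<And>i. i \<in> states Q \<Longrightarrow> 0 \<le> \<pi> i" "\<And>i. i \<notin> states Q \<Longrightarrow> \<pi> i = 0"
      "\<pi> summable_on states Q"
  shows "sp_power \<alpha> \<eta> P Q g f \<pi> =
    \<alpha> * (\<Sum>\<^sub>\<infinity>i\<in>states Q. \<Sum>m\<in>{1,2}. \<eta> m * P m * flow \<alpha> g f \<pi> i m)"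
proof -
  define G where "G m = (\<Sum>\<^sub>\<infinity>i\<in>states Q. \<pi> i * g i m)" for m
  define F where "F m = (\<Sum>\<^sub>\<infinity>i\<in>states Q - {0}. \<pi> i * f i m)" for m
  have fl: "((\<lambda>i. flow \<alpha> g f \<pi> i m) has_sum (G m + \<xi> * F m)) (states Q)" if "m \<in> {1,2}" for m
    unfolding G_def F_def using that g f by (intro has_sum_flow \<alpha> \<pi>) auto
  have G': "(\<Sum>\<^sub>\<infinity>i\<in>states Q. \<pi> i * \<eta> m * g i m) = \<eta> m * G m" for m
    unfolding G_def infsum_cmult_right'[symmetric] by (intro infsum_cong) (simp add: mult_ac)
  have F': "(\<Sum>\<^sub>\<infinity>i\<in>states Q - {0}. \<pi> i * \<eta> m * f i m) = \<eta> m * F m" for m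
    unfolding F_def infsum_cmult_right'[symmetric] by (intro infsum_cong) (simp add: mult_ac)
  have "sp_power \<alpha> \<eta> P Q g f \<pi> =
      \<alpha> * (\<eta> 1 * P 1 * (G 1 + \<xi> * F 1) + \<eta> 2 * P 2 * (G 2 + \<xi> * F 2))"
    unfolding sp_power_def G' F' sum_channel using \<alpha> by (simp add: xi_def field_simps del: One_nat_def)
  then show ?thesis
    by (simp only: lp_power_eq[OF fl fl] insert_iff simp_thms)
qed

text \<open>Dividing by \<alpha> and using \<open>\<eta> 1 + \<eta> 2 = 1\<close> turns local
  balance into the identity between flow and mass. The free values \<open>x\<close>,
  \<open>x'\<close> let it serve both directions of the correspondence.\<close>

lemma balance_iff:
  "x * up_rate \<alpha> \<eta> g i = x' * down_rate \<alpha> \<eta> f (Suc i) \<longleftrightarrow>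
    \<eta> 1 * (x * g i 1 + \<xi> * x' * f (Suc i) 1) + \<eta> 2 * (x * g i 2 + \<xi> * x' * f (Suc i) 2) = x"
proof -
  have "x * up_rate \<alpha> \<eta> g i = \<alpha> * (x * (\<eta> 1 + \<eta> 2) - x * (\<eta> 1 * g i 1 + \<eta> 2 * g i 2))"
    unfolding up_rate_def sum_channel by (simp add: algebra_simps del: One_nat_def)
  moreover have "x' * down_rate \<alpha> \<eta> f (Suc i) =
      \<alpha> * (\<xi> * x' * (\<eta> 1 * f (Suc i) 1 + \<eta> 2 * f (Suc i) 2))"
    unfolding down_rate_def sum_channel using \<alpha> by (simp add: xi_def del: One_nat_def)
  moreover have "\<alpha> * s = \<alpha> * t \<longleftrightarrow> s = t" for s t using \<alpha> by simp
  ultimately show ?thesis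
    using \<eta>(3) by (simp only:) (simp add: algebra_simps del: One_nat_def, linarith)
qed

lemma mass_flow:
  assumes "sp_feasible \<alpha> \<eta> P Q pmax g f \<pi>"
  shows "mass (flow \<alpha> g f \<pi>) = \<pi>"
proof
  fix i
  show "mass (flow \<alpha> g f \<pi>) i = \<pi> i"
  proof (cases "enat i < Q")
    case True
    then have "\<pi> i * up_rate \<alpha> \<eta> g i = \<pi> (Suc i) * down_rate \<alpha> \<eta> f (Suc i)"
      using assms by (auto simp: sp_feasible_def)
    then show ?thesis unfolding balance_iff mass_def flow_def .
  next
    \<comment> \<open>No balance equation is available from the capacity on; there both masses
      vanish by the no-overflow assumption and the convention.\<close>
    case False
    then have "\<pi> i = 0"
      using assms by (cases "enat i = Q") (auto simp: sp_feasible_def states_def)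
    moreover have "\<pi> (Suc i) = 0"
    proof -
      have "Suc i \<notin> states Q"
        using False by (cases Q) (auto simp: states_def)
      then show ?thesis using assms by (auto simp: sp_feasible_def)
    qed
    ultimately show ?thesis by (simp add: mass_def flow_def)
  qed
qed

lemma lp_feasible_iff:
  "lp_feasible \<alpha> \<eta> P Q pmax y \<longleftrightarrow>
    \<alpha> * (\<Sum>\<^sub>\<infinity>i\<in>states Q. \<Sum>m\<in>{1,2}. \<eta> m * P m * y i m) \<le> pmax \<and>
    (mass y has_sum 1) (states Q) \<and>
    (\<forall>i\<in>states Q. \<forall>m\<in>{1,2}. 0 \<le> y i m \<and> y i m \<le> mass y i + \<xi> * mass y (Suc i)) \<and>
    (\<forall>i. i \<notin> states Q \<longrightarrow> (\<forall>m\<in>{1,2}. y i m = 0)) \<and>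
    (\<forall>i. enat i = Q \<longrightarrow> (\<forall>m\<in>{1,2}. y i m = 0))"
proof -
  have "mass y = (\<lambda>i. \<Sum>m\<in>{1,2}. \<eta> m * y i m)" by (simp add: mass_def fun_eq_iff)
  then show ?thesis unfolding lp_feasible_def by (simp only:)
qed

lemma mass_outside:
  "lp_feasible \<alpha> \<eta> P Q pmax y \<Longrightarrow> i \<notin> states Q \<Longrightarrow> mass y i = 0"
  by (simp add: lp_feasible_iff mass_def)

lemma lp_feasible_nonneg:
  assumes "lp_feasible \<alpha> \<eta> P Q pmax y" "m \<in> {1,2}"
  shows "0 \<le> y i m"
  using assms by (cases "i \<in> states Q") (auto simp: lp_feasible_def)

lemma mass_nonneg: "lp_feasible \<alpha> \<eta> P Q pmax y \<Longrightarrow> 0 \<le> mass y i"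
  using lp_feasible_nonneg[of y 1 i] lp_feasible_nonneg[of y 2 i] \<eta> by (simp add: mass_def)

lemma lp_feasible_flow:
  assumes sp: "sp_feasible \<alpha> \<eta> P Q pmax g f \<pi>"
  shows "lp_feasible \<alpha> \<eta> P Q pmax (flow \<alpha> g f \<pi>)"
proof -
  have \<pi>: "\<And>i. i \<in> states Q \<Longrightarrow> 0 \<le> \<pi> i" "\<And>i. i \<notin> states Q \<Longrightarrow> \<pi> i = 0"
    "\<pi> summable_on states Q"
    using sp by (auto simp: sp_feasible_def intro: has_sum_imp_summable)
  have gf: "\<forall>i\<in>states Q. \<forall>m\<in>{1,2}. 0 \<le> g i m \<and> g i m \<le> 1"
    "\<forall>i\<in>states Q - {0}. \<forall>m\<in>{1,2}. 0 \<le> f i m \<and> f i m \<le> 1"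
    using sp by (auto simp: sp_feasible_def)
  have nn: "0 \<le> \<pi> i" for i using \<pi>(1,2)[of i] by fastforce
  have out: "\<pi> (Suc i) = 0" if "i \<notin> states Q" for i
    using that states_SucD \<pi>(2) by blast
  have last: "\<pi> i = 0 \<and> \<pi> (Suc i) = 0" if "enat i = Q" for i
    using that sp \<pi>(2)[of "Suc i"] by (auto simp: sp_feasible_def states_def simp flip: that)
  have bnd: "0 \<le> flow \<alpha> g f \<pi> i m \<and> flow \<alpha> g f \<pi> i m \<le> \<pi> i + \<xi> * \<pi> (Suc i)"
    if "i \<in> states Q" "m \<in> {1,2}" for i m
  proof -
    have "0 \<le> \<pi> i * g i m \<and> \<pi> i * g i m \<le> \<pi> i"
      using that gf(1) nn[of i] by (auto intro: mult_left_le)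
    moreover have "0 \<le> \<pi> (Suc i) * f (Suc i) m \<and> \<pi> (Suc i) * f (Suc i) m \<le> \<pi> (Suc i)"
      using that gf(2) nn[of "Suc i"] \<pi>(2)[of "Suc i"]
      by (cases "Suc i \<in> states Q") (auto intro: mult_left_le)
    ultimately show ?thesis
      using xi_pos unfolding flow_def mult.assoc
      by (intro conjI add_nonneg_nonneg add_mono mult_left_mono mult_nonneg_nonneg[of \<xi>]) auto
  qed
  have "\<alpha> * (\<Sum>\<^sub>\<infinity>i\<in>states Q. \<Sum>m\<in>{1,2}. \<eta> m * P m * flow \<alpha> g f \<pi> i m) \<le> pmax"
    using sp sp_power_eq[OF gf \<pi>] unfolding sp_feasible_def by metis
  moreover have "(\<pi> has_sum 1) (states Q)"
    using sp by (simp add: sp_feasible_def)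
  moreover have "flow \<alpha> g f \<pi> i m = 0" if "i \<notin> states Q \<or> enat i = Q" for i m
    using that \<pi>(2)[of i] out[of i] last[of i] by (auto simp: flow_def)
  ultimately show ?thesis
    unfolding lp_feasible_iff mass_flow[OF sp] using bnd by blast
qed

text \<open>The way back from (LP): once a policy realises \<open>y\<close> as its flow, the balance
  equations hold by the very definition of \<open>mass\<close>.\<close>

lemma sp_feasible_mass:
  assumes lp: "lp_feasible \<alpha> \<eta> P Q pmax y"
    and gf: "\<forall>i\<in>states Q. \<forall>m\<in>{1,2}. 0 \<le> g i m \<and> g i m \<le> 1"
      "\<forall>i\<in>states Q - {0}. \<forall>m\<in>{1,2}. 0 \<le> f i m \<and> f i m \<le> 1"
    and y: "\<And>i m. m \<in> {1,2} \<Longrightarrow> flow \<alpha> g f (mass y) i m = y i m"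
  shows "sp_feasible \<alpha> \<eta> P Q pmax g f (mass y)"
proof -
  have sum: "(mass y has_sum 1) (states Q)" using lp by (simp add: lp_feasible_iff)
  have "sp_power \<alpha> \<eta> P Q g f (mass y) =
      \<alpha> * (\<Sum>\<^sub>\<infinity>i\<in>states Q. \<Sum>m\<in>{1,2}. \<eta> m * P m * y i m)"
    using sp_power_eq[OF gf mass_nonneg[OF lp] mass_outside[OF lp] has_sum_imp_summable[OF sum]] y
    by simp
  also have "\<dots> \<le> pmax" using lp unfolding lp_feasible_iff by blast
  finally have "sp_power \<alpha> \<eta> P Q g f (mass y) \<le> pmax" .
  moreover have "mass y i * up_rate \<alpha> \<eta> g i = mass y (Suc i) * down_rate \<alpha> \<eta> f (Suc i)" for i
    unfolding balance_iff using y[of 1 i] y[of 2 i] by (simp add: flow_def mass_def)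
  moreover have "mass y i = 0" if "enat i = Q" for i
    using lp that by (simp add: lp_feasible_iff mass_def)
  ultimately show ?thesis
    using gf sum mass_nonneg[OF lp] mass_outside[OF lp] unfolding sp_feasible_def by blast
qed

lemma mass_sums:
  assumes "lp_feasible \<alpha> \<eta> P Q pmax y"
  shows "mass y sums 1"
  using assms mass_nonneg[OF assms] mass_outside[OF assms]
  by (simp add: lp_feasible_iff has_sum_states_iff_sums)

lemma lp_delay_eq:
  assumes "lp_feasible \<alpha> \<eta> P Q pmax y"
  shows "lp_delay \<alpha> \<eta> Q y = sp_delay \<alpha> Q (mass y)"
proof -
  have "(\<Sum>m\<in>{1,2}. ennreal (real i * \<eta> m * y i m)) = ennreal (real i * mass y i)" for i
    unfolding sum_channel using \<eta> lp_feasible_nonneg[OF assms, of _ i]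
    by (simp add: mass_def distrib_left mult.assoc ennreal_plus)
  then show ?thesis by (simp only: lp_delay_def sp_delay_def)
qed

lemma sp_delay_eq_tail_sum:
  assumes "lp_feasible \<alpha> \<eta> P Q pmax y"
  shows "sp_delay \<alpha> Q (mass y) = ennreal (1 / \<alpha>) * (\<Sum>k. ennreal (1 - (\<Sum>j<Suc k. mass y j)))"
proof -
  have "(\<Sum>\<^sub>\<infinity>i\<in>states Q. ennreal (real i * mass y i)) = (\<Sum>i. ennreal (real i * mass y i))"
    by (rule infsum_states_ennreal) (simp add: mass_outside[OF assms])
  then show ?thesis
    unfolding sp_delay_def using delay_eq_tail_sum[OF mass_sums[OF assms] mass_nonneg[OF assms]]
    by simp
qed

section \<open>The power constraint and the domination of tails\<close>

lemma lp_power_mass: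
  assumes "(mass y has_sum 1) A" "((\<lambda>i. y i 2) has_sum b) A"
  shows "\<alpha> * (\<Sum>\<^sub>\<infinity>i\<in>A. \<Sum>m\<in>{1,2}. \<eta> m * P m * y i m) = \<alpha> * (P 1 + (P 2 - P 1) * (\<eta> 2 * b))"
proof -
  \<comment> \<open>Normalisation determines the sum for the first channel state from
    \<open>b\<close>, so the power depends on \<open>b\<close> alone.\<close>
  have "((\<lambda>i. inverse (\<eta> 1) * (mass y i + - \<eta> 2 * y i 2)) has_sum
      (inverse (\<eta> 1) * (1 + - \<eta> 2 * b))) A"
    by (intro has_sum_cmult_right has_sum_add assms)
  moreover have "inverse (\<eta> 1) * (mass y i + - \<eta> 2 * y i 2) = y i 1" for i
    using \<eta> by (simp add: mass_def)
  ultimately have y1: "((\<lambda>i. y i 1) has_sum (inverse (\<eta> 1) * (1 - \<eta> 2 * b))) A"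
    by simp
  show ?thesis
    unfolding lp_power_eq[OF y1 assms(2)] using \<eta> by (simp add: field_simps del: One_nat_def)
qed

text \<open>Serving at \<open>P 1\<close> costs at least \<open>\<alpha> * P 1\<close>, while
  \<open>pmax\<close> is strictly below the power of always transmitting; together these exclude
  \<open>P 1 = P 2\<close> and give \<open>\<sigma> < r\<close>.\<close>

lemma lp_power_bound:
  assumes y: "lp_feasible \<alpha> \<eta> P Q pmax y"
  obtains b where "(\<lambda>i. y i 2) sums b" "0 \<le> b" "P 1 < P 2" "r * b \<le> \<sigma>" "\<sigma> < r"
proof -
  have m1: "(mass y has_sum 1) (states Q)" using y by (simp add: lp_feasible_iff)
  have nn: "0 \<le> y i 1" "0 \<le> y i 2" for i using lp_feasible_nonneg[OF y] by auto
  have "(\<lambda>i. inverse (\<eta> 2) * mass y i) summable_on states Q"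
    using m1 by (intro summable_on_cmult_right has_sum_imp_summable)
  then have "(\<lambda>i. y i 2) summable_on states Q"
    by (rule summable_on_comparison_test) (use nn \<eta> in \<open>auto simp: mass_def field_simps\<close>)
  then obtain b where b: "((\<lambda>i. y i 2) has_sum b) (states Q)"
    by (auto simp: summable_on_def)
  have b0: "0 \<le> b" using has_sum_nonneg[OF b] nn by blast
  have le: "\<alpha> * (P 1 + (P 2 - P 1) * (\<eta> 2 * b)) \<le> pmax"
    using y unfolding lp_feasible_iff lp_power_mass[OF m1 b] by blast
  have "\<eta> 1 = 1 - \<eta> 2" using \<eta> by simp
  then have gt: "pmax - \<alpha> * P 1 < \<alpha> * (P 2 - P 1) * \<eta> 2"
    using pmax unfolding \<open>\<eta> 1 = 1 - \<eta> 2\<close> by (simp add: algebra_simps)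
  have lt: "P 1 < P 2"
  proof (rule ccontr)
    assume "\<not> P 1 < P 2"
    with P have "P 1 = P 2" by simp
    with le gt show False by simp
  qed
  define c where "c = \<alpha> * (P 2 - P 1) * (\<eta> 1 * \<xi>)"
  have c: "0 < c" using lt \<alpha> \<eta> xi_pos by (simp add: c_def)
  have \<sigma>_eq: "\<sigma> = (pmax - \<alpha> * P 1) / c" by (simp add: \<sigma>_def c_def)
  have rc: "r * c = \<alpha> * (P 2 - P 1) * \<eta> 2" by (simp add: c_def \<eta>2_eq)
  have "r * b * c = b * (\<alpha> * (P 2 - P 1) * \<eta> 2)" using rc by (metis mult.assoc mult.commute)
  also have "\<dots> \<le> pmax - \<alpha> * P 1" using le by (simp add: algebra_simps)
  finally have "r * b \<le> \<sigma>" using c by (simp add: \<sigma>_eq pos_le_divide_eq)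
  moreover have "\<sigma> < r" using c gt rc by (simp add: \<sigma>_eq pos_divide_less_eq)
  moreover have "(\<lambda>i. y i 2) sums b"
    using b y nn(2) by (subst has_sum_states_iff_sums[symmetric]) (auto simp: lp_feasible_iff)
  ultimately show thesis using that b0 lt by blast
qed

lemma geo_tail_le_mass_tail:
  assumes y: "lp_feasible \<alpha> \<eta> P Q pmax y"
  shows "geo_tail r p k \<le> 1 - (\<Sum>j<k. mass y j)"
proof -
  obtain b where b: "(\<lambda>i. y i 2) sums b" "r * b \<le> \<sigma>" using lp_power_bound[OF y] by blast
  have d: "r * mass y i - mass y (Suc i) \<le> r * y i 2" for i
  proof -
    have "y i 1 \<le> mass y i + \<xi> * mass y (Suc i)"
    proof (cases "i \<in> states Q")
      case True
      then show ?thesis using y by (simp add: lp_feasible_iff)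
    next
      case False
      then show ?thesis
        using y xi_pos mass_nonneg[OF y] by (simp add: lp_feasible_iff)
    qed
    then have "\<eta> 1 * y i 1 \<le> \<eta> 1 * (mass y i + \<xi> * mass y (Suc i))"
      using \<eta> by (intro mult_left_mono) auto
    moreover have "mass y i = \<eta> 1 * y i 1 + \<eta> 2 * y i 2" by (simp add: mass_def)
    moreover have "(\<eta> 1 + \<eta> 2) * mass y i = mass y i" using \<eta> by simp
    \<comment> \<open>Mass that the first channel state cannot carry must use the second:
      \<open>\<eta> 1 * y i 1\<close> is eliminated through the definition of
      \<open>mass\<close>.\<close>
    ultimately have "\<eta> 2 * mass y i - \<eta> 1 * \<xi> * mass y (Suc i) \<le> \<eta> 2 * y i 2"
      by (simp only: distrib_left distrib_right mult.assoc)
    then have "(\<eta> 1 * \<xi>) * (r * mass y i - mass y (Suc i)) \<le> (\<eta> 1 * \<xi>) * (r * y i 2)"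
      by (simp add: \<eta>2_eq algebra_simps)
    then show ?thesis using \<eta> xi_pos by (subst (asm) mult_le_cancel_left_pos) auto
  qed
  show ?thesis unfolding p_def
    by (rule geo_tail_lower_bound[where u = "\<lambda>i. r * y i 2" and U = "r * b"])
       (use d mass_sums[OF y] mass_nonneg[OF y] b r_pos lp_feasible_nonneg[OF y, of 2]
        in \<open>auto intro: sums_mult\<close>)
qed

section \<open>The extremal point, its feasibility and its uniqueness\<close>

definition opt_mass :: "nat \<Rightarrow> real" where
  "opt_mass i = geo_tail r p i - geo_tail r p (Suc i)"

text \<open>The first channel state is used up to its (LP) bound; the second entry is then forced by
  the mass, with \<open>\<eta> 1 * \<xi> / \<eta> 2 = 1 / r\<close>.\<close>

definition opt_flow :: "nat \<Rightarrow> nat \<Rightarrow> real" where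
  "opt_flow i m =
    (if m = 1 then opt_mass i + \<xi> * opt_mass (Suc i) else opt_mass i - opt_mass (Suc i) / r)"

lemma sum_opt_mass: "(\<Sum>j<k. opt_mass j) = 1 - geo_tail r p k"
  by (induction k) (simp_all add: opt_mass_def)

lemma mass_opt_flow: "mass opt_flow = opt_mass"
proof
  fix i
  have *: "\<eta> 2 * (x / r) = \<eta> 1 * \<xi> * x" for x using r_pos by (simp add: \<eta>2_eq)
  have "mass opt_flow i = (\<eta> 1 + \<eta> 2) * opt_mass i"
    unfolding mass_def opt_flow_def
    by (simp add: right_diff_distrib * del: times_divide_eq_right) (simp add: algebra_simps)
  then show "mass opt_flow i = opt_mass i" using \<eta> by simp
qed

text \<open>While truncation does not act up to index \<open>i + 2\<close>, the masses are exactly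
  \<open>p * r ^ i\<close>, and the second channel state stays idle.\<close>

lemma opt_mass_Suc:
  assumes "0 \<le> p" "p * geo_sum r (Suc (Suc i)) \<le> 1"
  shows "opt_mass (Suc i) = r * opt_mass i"
proof -
  have "p * geo_sum r k \<le> 1" if "k \<le> Suc (Suc i)" for k
    using mult_left_mono[OF geo_sum_mono[OF that less_imp_le[OF r_pos]] assms(1)] assms(2)
    by linarith
  then have "geo_tail r p k = 1 - p * geo_sum r k" if "k \<le> Suc (Suc i)" for k
    using that by (simp add: geo_tail_def)
  then show ?thesis by (simp add: opt_mass_def geo_sum_Suc') (simp add: algebra_simps)
qed

text \<open>The existence of one feasible point \<open>y\<close> already forces the parameters into
  the range in which the extremal point is feasible.\<close>

context
  fixes y
  assumes y: "lp_feasible \<alpha> \<eta> P Q pmax y"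
begin

lemma \<sigma>_bounds: "0 \<le> \<sigma>" "\<sigma> < r"
  using lp_power_bound[OF y] r_pos by (metis mult_nonneg_nonneg less_imp_le order_trans)+

lemma geo_tail_tendsto_0: "geo_tail r p \<longlonglongrightarrow> 0"
proof (rule tendsto_sandwich[OF _ _ tendsto_const])
  show "(\<lambda>k. 1 - (\<Sum>j<k. mass y j)) \<longlonglongrightarrow> 0"
    using tendsto_diff[OF tendsto_const[of 1] mass_sums[OF y, unfolded sums_def]] by simp
qed (simp_all add: geo_tail_le_mass_tail[OF y])

lemma p_bounds: "0 < p" "p < 1"
proof -
  show "p < 1" using \<sigma>_bounds by (simp add: p_def)
  \<comment> \<open>Domination at index 1 puts \<open>p\<close> above the mass of \<open>y\<close>
    at 0; with \<open>p = 0\<close> all tails would stay at 1.\<close>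
  have "1 - p \<le> 1 - mass y 0"
    using geo_tail_le_mass_tail[OF y, of 1] by (simp add: geo_tail_def geo_sum_def)
  then have "0 \<le> p" using mass_nonneg[OF y, of 0] by simp
  moreover have "p \<noteq> 0"
  proof
    assume "p = 0"
    then have "geo_tail r p = (\<lambda>_. 1)" by (auto simp: geo_tail_def)
    then show False using geo_tail_tendsto_0 LIMSEQ_unique[OF tendsto_const] by fastforce
  qed
  ultimately show "0 < p" by simp
qed

lemma opt_mass_0: "opt_mass 0 = p"
  using p_bounds by (simp add: opt_mass_def geo_tail_def geo_sum_def)

lemma opt_mass_nonneg: "0 \<le> opt_mass i"
  using geo_tail_antimono[of i "Suc i" r p] p_bounds r_pos by (simp add: opt_mass_def)

lemma opt_mass_sums: "opt_mass sums 1"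
  unfolding opt_mass_def using telescope_sums'[OF geo_tail_tendsto_0] by simp

lemma opt_mass_Suc_sums: "(\<lambda>i. opt_mass (Suc i)) sums (1 - p)"
  using opt_mass_sums by (subst sums_Suc_iff) (simp add: opt_mass_0)

text \<open>Consecutive tails are related by \<open>max 0 (r * t - \<sigma>)\<close>, a map with
  Lipschitz constant \<open>r\<close>. This makes the second entry of \<open>opt_flow\<close>
  nonnegative.\<close>

lemma opt_mass_Suc_le: "opt_mass (Suc i) \<le> r * opt_mass i"
proof -
  have *: "geo_tail r p (Suc k) = max 0 (r * geo_tail r p k - \<sigma>)" for k
    using geo_tail_Suc[of r p k] r_pos \<sigma>_bounds by (simp add: p_def)
  have "r * geo_tail r p (Suc i) \<le> r * geo_tail r p i"
    using geo_tail_antimono[of i "Suc i" r p] p_bounds r_pos by simp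
  then show ?thesis
    unfolding opt_mass_def using *[of i] *[of "Suc i"] \<sigma>_bounds
    by (simp add: right_diff_distrib max_def split: if_splits)
qed

text \<open>The tail of \<open>y\<close> at such an index is 0 and dominates the extremal one, so
  the capacity restriction is inherited.\<close>

lemma opt_mass_eq_0:
  assumes "i \<notin> states Q \<or> enat i = Q"
  shows "opt_mass i = 0"
proof -
  have "mass y j = 0" if "i \<le> j" for j
  proof (cases "enat j = Q")
    case True
    then show ?thesis using y by (simp add: lp_feasible_iff mass_def)
  next
    case False
    then have "j \<notin> states Q"
      using that assms by (cases Q) (auto simp: states_def)
    then show ?thesis by (rule mass_outside[OF y])
  qed
  then have "mass y sums (\<Sum>j<i. mass y j)"
    by (intro sums_finite) (auto simp: not_less)
  then have "(\<Sum>j<i. mass y j) = 1"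
    using mass_sums[OF y] sums_unique2 by blast
  then have "geo_tail r p i \<le> 0" using geo_tail_le_mass_tail[OF y, of i] by simp
  then show ?thesis
    using geo_tail_antimono[of i "Suc i" r p] p_bounds r_pos geo_tail_nonneg[of r p "Suc i"]
    unfolding opt_mass_def by linarith
qed

lemma opt_flow_bounds:
  assumes "m \<in> {1, 2}"
  shows "0 \<le> opt_flow i m" "opt_flow i m \<le> opt_mass i + \<xi> * opt_mass (Suc i)"
proof -
  have "0 \<le> opt_mass (Suc i) / r" "0 \<le> \<xi> * opt_mass (Suc i)"
    using opt_mass_nonneg r_pos xi_pos by simp_all
  moreover have "opt_mass (Suc i) / r \<le> opt_mass i"
    using opt_mass_Suc_le[of i] r_pos by (simp add: pos_divide_le_eq mult.commute)
  ultimately show "0 \<le> opt_flow i m" "opt_flow i m \<le> opt_mass i + \<xi> * opt_mass (Suc i)"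
    using opt_mass_nonneg[of i] unfolding opt_flow_def by (auto split: if_splits)
qed

lemma opt_flow_eq_0:
  assumes "i \<notin> states Q \<or> enat i = Q"
  shows "opt_flow i m = 0"
proof -
  have "Suc i \<notin> states Q" using assms states_SucD[of i Q] by (auto simp: states_def)
  then show ?thesis using opt_mass_eq_0 assms by (simp add: opt_flow_def)
qed

lemma lp_feasible_opt_flow: "lp_feasible \<alpha> \<eta> P Q pmax opt_flow"
proof -
  have m1: "(opt_mass has_sum 1) (states Q)"
    using opt_mass_sums opt_mass_eq_0 opt_mass_nonneg by (simp add: has_sum_states_iff_sums)
  have "(\<lambda>i. opt_flow i 2) sums (1 - (1 - p) / r)"
    unfolding opt_flow_def using sums_diff[OF opt_mass_sums sums_divide[OF opt_mass_Suc_sums]]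
    by simp
  also have "1 - (1 - p) / r = \<sigma> / r"
    using r_pos by (simp add: p_def field_simps)
  finally have "((\<lambda>i. opt_flow i 2) has_sum (\<sigma> / r)) (states Q)"
    using opt_flow_eq_0 opt_flow_bounds by (simp add: has_sum_states_iff_sums)
  then have "\<alpha> * (\<Sum>\<^sub>\<infinity>i\<in>states Q. \<Sum>m\<in>{1,2}. \<eta> m * P m * opt_flow i m) =
      \<alpha> * (P 1 + (P 2 - P 1) * (\<eta> 2 * (\<sigma> / r)))"
    using m1 by (intro lp_power_mass) (simp_all add: mass_opt_flow)
  also have "\<eta> 2 * (\<sigma> / r) = \<eta> 1 * \<xi> * \<sigma>"
    using r_pos by (simp add: \<eta>2_eq)
  also have "\<alpha> * (P 1 + (P 2 - P 1) * (\<eta> 1 * \<xi> * \<sigma>)) =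
      \<alpha> * P 1 + (\<alpha> * (P 2 - P 1) * (\<eta> 1 * \<xi>)) * \<sigma>"
    by (simp add: algebra_simps)
  \<comment> \<open>The denominator of \<open>\<sigma>\<close> is nonzero because
    \<open>P 1 < P 2\<close>; the extremal point spends the budget exactly.\<close>
  also have "\<dots> = pmax"
    using lp_power_bound[OF y] \<alpha> \<eta> xi_pos unfolding \<sigma>_def by fastforce
  finally have "\<alpha> * (\<Sum>\<^sub>\<infinity>i\<in>states Q. \<Sum>m\<in>{1,2}. \<eta> m * P m * opt_flow i m) \<le> pmax"
    by (rule eq_refl)
  then show ?thesis
    unfolding lp_feasible_iff mass_opt_flow
    using m1 opt_flow_bounds opt_flow_eq_0 by blast
qed

lemma delay_opt_flow_le: "lp_delay \<alpha> \<eta> Q opt_flow \<le> lp_delay \<alpha> \<eta> Q y"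
  unfolding lp_delay_eq[OF y] lp_delay_eq[OF lp_feasible_opt_flow]
    sp_delay_eq_tail_sum[OF y] sp_delay_eq_tail_sum[OF lp_feasible_opt_flow]
  using geo_tail_le_mass_tail[OF y]
  by (intro mult_left_mono suminf_le summableI ennreal_leI)
     (simp_all only: mass_opt_flow sum_opt_mass diff_diff_eq2 add_diff_cancel_left' zero_le)

text \<open>Dominating tails with no larger sum must agree with the extremal ones, and masses are
  differences of tails.\<close>

lemma mass_eq_opt_mass:
  assumes "lp_delay \<alpha> \<eta> Q y \<le> lp_delay \<alpha> \<eta> Q opt_flow"
  shows "mass y = opt_mass"
proof -
  have "ennreal (1 / \<alpha>) * (\<Sum>k. ennreal (1 - (\<Sum>j<Suc k. mass y j))) \<le>
      ennreal (1 / \<alpha>) * (\<Sum>k. ennreal (1 - (\<Sum>j<Suc k. opt_mass j)))"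
    using assms
    unfolding lp_delay_eq[OF y] lp_delay_eq[OF lp_feasible_opt_flow]
      sp_delay_eq_tail_sum[OF y] sp_delay_eq_tail_sum[OF lp_feasible_opt_flow]
    unfolding mass_opt_flow .
  then have le: "(\<Sum>k. ennreal (1 - (\<Sum>j<Suc k. mass y j))) \<le> (\<Sum>k. ennreal (geo_tail r p (Suc k)))"
    using \<alpha> by (subst (asm) ennreal_mult_le_mult_iff) (auto simp: sum_opt_mass simp del: sum.lessThan_Suc)
  have "(\<lambda>k. 1 - (\<Sum>j<Suc k. mass y j)) = (\<lambda>k. geo_tail r p (Suc k))"
    using summable_geo_tail[OF r_pos p_bounds(1) geo_tail_tendsto_0]
      geo_tail_le_mass_tail[OF y] le
    by (intro eq_if_suminf_ennreal_le) (simp_all add: summable_Suc_iff del: sum.lessThan_Suc)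
  then have tail: "1 - (\<Sum>j<Suc k. mass y j) = geo_tail r p (Suc k)" for k
    by (rule fun_cong)
  have eq: "(\<Sum>j<k. mass y j) = (\<Sum>j<k. opt_mass j)" for k
  proof (cases k)
    case (Suc k')
    then show ?thesis using tail[of k'] by (simp only: sum_opt_mass)
  qed simp
  show ?thesis
  proof
    fix k
    show "mass y k = opt_mass k" using eq[of k] eq[of "Suc k"] by simp
  qed
qed

end

section \<open>Optimal policies and the threshold\<close>

lemma lp_optimal_opt_flow:
  assumes "lp_feasible \<alpha> \<eta> P Q pmax y"
  shows "lp_optimal \<alpha> \<eta> P Q pmax opt_flow"
  using lp_feasible_opt_flow[OF assms] delay_opt_flow_le
  by (auto simp: lp_optimal_def is_arg_min_def not_less)

text \<open>A policy realising \<open>opt_flow\<close> makes the extremal point a competitor within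
  (SP), so the optimal \<pi> cannot have larger delay and uniqueness applies; the delay depends on
  \<pi> only, so that policy is optimal too.\<close>

lemma sp_optimal_eq_opt_mass:
  assumes "sp_optimal \<alpha> \<eta> P Q pmax g f \<pi>"
    and g': "\<forall>i\<in>states Q. \<forall>m\<in>{1,2}. 0 \<le> g' i m \<and> g' i m \<le> 1"
    and f': "\<forall>i\<in>states Q - {0}. \<forall>m\<in>{1,2}. 0 \<le> f' i m \<and> f' i m \<le> 1"
    and fl: "\<forall>i. \<forall>m\<in>{1,2}. flow \<alpha> g' f' opt_mass i m = opt_flow i m"
  shows "\<pi> = opt_mass" "sp_optimal \<alpha> \<eta> P Q pmax g' f' \<pi>"
proof -
  have sp: "sp_feasible \<alpha> \<eta> P Q pmax g f \<pi>"
    and opt: "sp_feasible \<alpha> \<eta> P Q pmax g0 f0 \<pi>0 \<Longrightarrow> sp_delay \<alpha> Q \<pi> \<le> sp_delay \<alpha> Q \<pi>0"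
    for g0 f0 \<pi>0
    using assms(1) by (auto simp: sp_optimal_def is_arg_min_def not_less)
  note y = lp_feasible_flow[OF sp]
  have sp': "sp_feasible \<alpha> \<eta> P Q pmax g' f' opt_mass"
    using sp_feasible_mass[OF lp_feasible_opt_flow[OF y] g' f'] fl by (simp add: mass_opt_flow)
  have "lp_delay \<alpha> \<eta> Q (flow \<alpha> g f \<pi>) \<le> lp_delay \<alpha> \<eta> Q opt_flow"
    unfolding lp_delay_eq[OF y] lp_delay_eq[OF lp_feasible_opt_flow[OF y]]
      mass_flow[OF sp] mass_opt_flow
    by (rule opt[OF sp'])
  then show "\<pi> = opt_mass"
    using mass_eq_opt_mass[OF y] mass_flow[OF sp] by simp
  with sp' opt show "sp_optimal \<alpha> \<eta> P Q pmax g' f' \<pi>"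
    by (auto simp: sp_optimal_def is_arg_min_def not_less)
qed

text \<open>One function serves arrivals at level \<open>i\<close> and departures from level
  \<open>i + 1\<close>: the share of the (LP) bound in use. From the threshold on this share is 1 or
  \<open>0 / 0\<close>, hence the prescribed value.\<close>

definition opt_policy :: "nat \<Rightarrow> nat \<Rightarrow> real" where
  "opt_policy i m =
    (if m = 1 \<or> threshold r p \<le> ereal (real i) then 1
     else opt_flow i m / (opt_mass i + \<xi> * opt_mass (Suc i)))"

lemma opt_policy_bounds:
  assumes "lp_feasible \<alpha> \<eta> P Q pmax y" "m \<in> {1,2}"
  shows "0 \<le> opt_policy i m" "opt_policy i m \<le> 1"
  using opt_flow_bounds[OF assms, of i] by (auto simp: opt_policy_def divide_le_eq_1)

text \<open>For a finite threshold \<open>n\<close>, the tails vanish from \<open>n + 1\<close> on,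
  whereas \<open>i + 2 \<le> n\<close> keeps level \<open>i\<close> in the purely geometric range.
  Only level \<open>n - 1\<close> may use the second channel state partially.\<close>

lemma threshold_opt:
  assumes y: "lp_feasible \<alpha> \<eta> P Q pmax y"
  shows "threshold r p \<le> ereal (real i) \<Longrightarrow> opt_mass (Suc i) = 0"
    and "ereal (real i) < threshold r p - 1 \<Longrightarrow> opt_flow i 2 = 0"
proof -
  have small: "opt_flow i 2 = 0" if "p * geo_sum r (Suc (Suc i)) \<le> 1"
    using opt_mass_Suc[OF _ that] p_bounds[OF y] r_pos by (simp add: opt_flow_def)
  have "(threshold r p \<le> ereal (real i) \<longrightarrow> opt_mass (Suc i) = 0) \<and>
    (ereal (real i) < threshold r p - 1 \<longrightarrow> opt_flow i 2 = 0)"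
  proof (rule threshold_cases[OF r_pos p_bounds(1)[OF y] less_imp_le[OF p_bounds(2)[OF y]]
      geo_tail_tendsto_0[OF y]])
    assume "threshold r p = \<infinity>" "\<And>k. p * geo_sum r k \<le> 1"
    then show ?thesis using small by simp
  next
    fix n assume n: "threshold r p = ereal (real n)" "p * geo_sum r n \<le> 1"
      "1 < p * geo_sum r (Suc n)"
    have "opt_mass (Suc i) = 0" if "n \<le> i"
    proof -
      have "geo_tail r p k = 0" if "Suc n \<le> k" for k
        using geo_tail_antimono[OF that, of r p] n(3) geo_tail_nonneg[of r p k] r_pos
          p_bounds[OF y]
        by (simp add: geo_tail_def)
      with that show ?thesis by (simp add: opt_mass_def)
    qed
    moreover have "opt_flow i 2 = 0" if "Suc i < n"
    proof (rule small)
      have "p * geo_sum r (Suc (Suc i)) \<le> p * geo_sum r n"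
        using that r_pos p_bounds[OF y] by (intro mult_left_mono geo_sum_mono) auto
      with n(2) show "p * geo_sum r (Suc (Suc i)) \<le> 1" by simp
    qed
    moreover have "Suc i < n" if "ereal (real i) < ereal (real n) - 1"
      using that by (simp add: one_ereal_def)
    ultimately show ?thesis unfolding n(1) by auto
  qed
  then show "threshold r p \<le> ereal (real i) \<Longrightarrow> opt_mass (Suc i) = 0"
    "ereal (real i) < threshold r p - 1 \<Longrightarrow> opt_flow i 2 = 0" by auto
qed

lemma flow_opt_policy:
  assumes y: "lp_feasible \<alpha> \<eta> P Q pmax y" and m: "m \<in> {1,2}"
  shows "flow \<alpha> opt_policy (\<lambda>i. opt_policy (i - 1)) opt_mass i m = opt_flow i m"
proof -
  have eq: "flow \<alpha> opt_policy (\<lambda>i. opt_policy (i - 1)) opt_mass i m =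
      opt_policy i m * (opt_mass i + \<xi> * opt_mass (Suc i))"
    by (simp add: flow_def algebra_simps)
  consider "m = 1" | "m = 2" "threshold r p \<le> ereal (real i)"
    | "m = 2" "\<not> threshold r p \<le> ereal (real i)" using m by blast
  then show ?thesis
  proof cases
    case 1
    then show ?thesis unfolding eq by (simp add: opt_policy_def opt_flow_def)
  next
    case 2
    then show ?thesis unfolding eq using threshold_opt(1)[OF y, of i]
      by (simp add: opt_policy_def opt_flow_def)
  next
    case 3
    \<comment> \<open>If the denominator is 0, the bounds force \<open>opt_flow i m = 0\<close>, in
      agreement with the default quotient.\<close>
    then show ?thesis unfolding eq using opt_flow_bounds[OF y m, of i]
      by (auto simp: opt_policy_def)
  qed
qed

end

theorem corollary6:
  fixes \<alpha> pmax :: real and \<eta> P :: "nat \<Rightarrow> real" and Q :: enat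
    and g f :: "nat \<Rightarrow> nat \<Rightarrow> real" and \<pi> :: "nat \<Rightarrow> real"
  assumes "0 < \<alpha>" "\<alpha> < 1"
    and "0 < \<eta> 1" "0 < \<eta> 2" "\<eta> 1 + \<eta> 2 = 1"
    and "0 < P 1" "P 1 \<le> P 2"
    and "0 < Q"
    and "pmax < \<alpha> * (\<eta> 1 * P 1 + \<eta> 2 * P 2)"
    and "sp_optimal \<alpha> \<eta> P Q pmax g f \<pi>"
    and "sp_power \<alpha> \<eta> P Q g f \<pi> = pmax"
  defines "i\<^sub>2 \<equiv> threshold ((1 - \<eta> 1) / (\<eta> 1 * xi \<alpha>)) (\<pi> 0)"
  shows "\<exists>g' f' y.
    sp_optimal \<alpha> \<eta> P Q pmax g' f' \<pi> \<and>
    lp_optimal \<alpha> \<eta> P Q pmax y \<and>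
    (\<forall>i\<in>states Q. \<pi> i = \<eta> 1 * y i 1 + \<eta> 2 * y i 2) \<and>
    (\<forall>i\<in>states Q. g' i 1 = 1) \<and>
    (\<forall>i. Suc i \<in> states Q \<longrightarrow> f' (Suc i) 1 = 1) \<and>
    (\<forall>i\<in>states Q.
      (ereal (real i) < i\<^sub>2 - 1 \<longrightarrow>
         g' i 2 = 0 \<and> (Suc i \<in> states Q \<longrightarrow> f' (Suc i) 2 = 0)) \<and>
      (ereal (real i) = i\<^sub>2 - 1 \<longrightarrow>
         \<eta> 2 * (\<pi> i * g' i 2 + xi \<alpha> * \<pi> (Suc i) * f' (Suc i) 2) = \<eta> 2 * y i 2) \<and>
      (i\<^sub>2 \<le> ereal (real i) \<longrightarrow>
         g' i 2 = 1 \<and> (Suc i \<in> states Q \<longrightarrow> f' (Suc i) 2 = 1)))"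
proof -
  interpret two_state_channel \<alpha> pmax \<eta> P Q
    using assms by unfold_locales
  have sp: "sp_feasible \<alpha> \<eta> P Q pmax g f \<pi>"
    using assms(10) by (simp add: sp_optimal_def is_arg_min_def)
  note y = lp_feasible_flow[OF sp]
  let ?f = "\<lambda>i. opt_policy (i - 1)"
  have fl: "\<forall>i. \<forall>m\<in>{1,2}. flow \<alpha> opt_policy ?f opt_mass i m = opt_flow i m"
    using flow_opt_policy[OF y] by blast
  have "\<forall>i\<in>states Q. \<forall>m\<in>{1,2}. 0 \<le> opt_policy i m \<and> opt_policy i m \<le> 1"
    "\<forall>i\<in>states Q - {0}. \<forall>m\<in>{1,2}. 0 \<le> ?f i m \<and> ?f i m \<le> 1"
    using opt_policy_bounds[OF y] by blast+
  note opt = sp_optimal_eq_opt_mass[OF assms(10) this fl]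
  \<comment> \<open>Since \<pi> is the extremal distribution, \<open>\<pi> 0 = p\<close>.\<close>
  have i2: "i\<^sub>2 = threshold r p"
    using opt_mass_0[OF y] by (simp add: i\<^sub>2_def r_def opt(1))
  have mass: "\<pi> i = \<eta> 1 * opt_flow i 1 + \<eta> 2 * opt_flow i 2" for i
    unfolding opt(1) mass_def[symmetric] mass_opt_flow ..
  have low: "opt_policy i 2 = 0" if "ereal (real i) < i\<^sub>2 - 1" for i
  proof -
    \<comment> \<open>This selects the quotient branch of \<open>opt_policy\<close>, also for an
      infinite threshold; its numerator is 0 there.\<close>
    have "\<not> i\<^sub>2 \<le> ereal (real i)"
      using that by (cases i\<^sub>2) (auto simp: one_ereal_def)
    then show ?thesis
      using threshold_opt(2)[OF y, of i] that by (simp add: opt_policy_def i2)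
  qed
  show ?thesis
  proof (intro exI conjI ballI allI impI)
    show "sp_optimal \<alpha> \<eta> P Q pmax opt_policy ?f \<pi>" by (rule opt(2))
    show "lp_optimal \<alpha> \<eta> P Q pmax opt_flow" by (rule lp_optimal_opt_flow[OF y])
    show "\<pi> i = \<eta> 1 * opt_flow i 1 + \<eta> 2 * opt_flow i 2" for i by (rule mass)
    \<comment> \<open>The equation required at the threshold level holds at every level, because the
      policy realises \<open>opt_flow\<close>.\<close>
    show "\<eta> 2 * (\<pi> i * opt_policy i 2 + xi \<alpha> * \<pi> (Suc i) * ?f (Suc i) 2) = \<eta> 2 * opt_flow i 2" for i
      using fl by (simp add: flow_def opt(1))
  qed (use low i2 in \<open>simp_all add: opt_policy_def\<close>)
qed

end
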